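(* Let $(G=N\rtimes H,d)$ be a metric group such that $\pi_H:G\to H$ is a Lipschitz map. Let $\phi:N\to H$ be a map, let $m\in N$ and put $p=m\cdot\phi(m)$. Then the following statements are equivalent: (1) there is a constant $L>0$ such that $\phi$ is intrinsically $L$-Lipschitz at the point $m$ with respect to $d$; (2) there is $\alpha\in(0,1)$ such that $p\cdot C_{N,H}(\alpha)\cap\Gamma_\phi=\{p\}$.
   Context: A metric group is a topological group $G$ with a left-invariant distance $d$ inducing its topology. $G=N\rtimes H$ means that $N,H$ are subgroups of $G$, $N$ is normal, $N\cap H=\{1\}$ and $G=NH$; every $g\in G$ is written uniquely as $g=\pi_N(g)\pi_H(g)$ with $\pi_N(g)\in N$, $\pi_H(g)\in H$. For $\phi:N\to H$ the intrinsic graph is $\Gamma_\phi=\{n\cdot\phi(n): n\in N\}$. The map $\phi$ is intrinsically $L$-Lipschitz at $m\in N$ if, with $p=m\phi(m)$, $d(1,\pi_H(p^{-1}x))\le L\,d(1,\pi_N(p^{-1}x))$ for all $x\in\Gamma_\phi$. For $\alpha\ge0$ the intrinsic cone is $C_{N,H}(\alpha)=\{g\in G: d(1,\pi_N(g))\le\alpha\, d(1,\pi_H(g))\}$, and $p\cdot C_{N,H}(\alpha)$ is its left translate by $p$. *)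

theory Defs
  imports "HOL-Analysis.Analysis" "HOL-Algebra.Coset"
begin

locale topological_group = group G for G (structure) +
  fixes T :: "'a topology"
  assumes topspace_eq: "topspace T = carrier G"
    and continuous_mult: "continuous_map (prod_topology T T) T (\<lambda>(x, y). x \<otimes> y)"
    and continuous_inv: "continuous_map T T (\<lambda>x. inv x)"

locale metric_group = topological_group G T + Metric_space "carrier G" d
  for G (structure) and T :: "'a topology" and d :: "'a \<Rightarrow> 'a \<Rightarrow> real" +
  assumes induces_topology: "mtopology = T"
    and left_invariant:
      "\<lbrakk>g \<in> carrier G; x \<in> carrier G; y \<in> carrier G\<rbrakk> \<Longrightarrow> d (g \<otimes> x) (g \<otimes> y) = d x y"

locale semidirect_product = group G + N: normal N G + H: subgroup H G
  for G (structure) and N and H +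
  assumes trivial_inter: "N \<inter> H = {\<one>}"
    and set_mult_eq: "N <#> H = carrier G"

text \<open>Only meaningful for \<open>g \<in> carrier G\<close> with \<open>semidirect_product G N H\<close>, where \<open>g\<close>
  factors uniquely as an element of \<open>N\<close> times an element of \<open>H\<close>, in this order.\<close>

definition proj_N :: "('a, 'b) monoid_scheme \<Rightarrow> 'a set \<Rightarrow> 'a set \<Rightarrow> 'a \<Rightarrow> 'a" where
  "proj_N G N H g = (THE n. n \<in> N \<and> (\<exists>h\<in>H. g = n \<otimes>\<^bsub>G\<^esub> h))"

definition proj_H :: "('a, 'b) monoid_scheme \<Rightarrow> 'a set \<Rightarrow> 'a set \<Rightarrow> 'a \<Rightarrow> 'a" where
  "proj_H G N H g = (THE h. h \<in> H \<and> (\<exists>n\<in>N. g = n \<otimes>\<^bsub>G\<^esub> h))"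

lemma (in semidirect_product) factors_unique:
  assumes "n \<in> N" "n' \<in> N" "h \<in> H" "h' \<in> H" "n \<otimes> h = n' \<otimes> h'"
  shows "n = n' \<and> h = h'"
proof -
  have c: "n \<in> carrier G" "n' \<in> carrier G" "h \<in> carrier G" "h' \<in> carrier G"
    using assms N.subset H.subset by auto
  have "inv n' \<otimes> n = inv n' \<otimes> (n \<otimes> h) \<otimes> inv h"
    using c by (simp add: m_assoc)
  also have "\<dots> = h' \<otimes> inv h"
    using c assms(5) by (simp add: m_assoc[symmetric])
  finally have e: "inv n' \<otimes> n = h' \<otimes> inv h" .
  have "inv n' \<otimes> n \<in> N" "h' \<otimes> inv h \<in> H"
    using assms by auto
  then have "inv n' \<otimes> n = \<one>"
    using e trivial_inter by auto
  then have "n = n'"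
    using c by (metis inv_equality inv_inv inv_closed)
  then show ?thesis
    using assms(5) c by simp
qed

lemma (in semidirect_product) proj_eqs:
  assumes "n \<in> N" "h \<in> H"
  shows "proj_N G N H (n \<otimes> h) = n" and "proj_H G N H (n \<otimes> h) = h"
  unfolding proj_N_def proj_H_def
  using assms by (auto intro!: the_equality dest: factors_unique)

definition intrinsic_graph :: "('a, 'b) monoid_scheme \<Rightarrow> 'a set \<Rightarrow> ('a \<Rightarrow> 'a) \<Rightarrow> 'a set" where
  "intrinsic_graph G N \<phi> = {n \<otimes>\<^bsub>G\<^esub> \<phi> n | n. n \<in> N}"

definition intrinsically_Lipschitz_at ::
  "('a, 'b) monoid_scheme \<Rightarrow> 'a set \<Rightarrow> 'a set \<Rightarrow> ('a \<Rightarrow> 'a \<Rightarrow> real) \<Rightarrow> real \<Rightarrow> ('a \<Rightarrow> 'a) \<Rightarrow> 'a \<Rightarrow> bool"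
  where
  "intrinsically_Lipschitz_at G N H d L \<phi> m \<longleftrightarrow>
    (let p = m \<otimes>\<^bsub>G\<^esub> \<phi> m in
      \<forall>x\<in>intrinsic_graph G N \<phi>.
        d \<one>\<^bsub>G\<^esub> (proj_H G N H (inv\<^bsub>G\<^esub> p \<otimes>\<^bsub>G\<^esub> x))
          \<le> L * d \<one>\<^bsub>G\<^esub> (proj_N G N H (inv\<^bsub>G\<^esub> p \<otimes>\<^bsub>G\<^esub> x)))"

definition intrinsic_cone ::
  "('a, 'b) monoid_scheme \<Rightarrow> 'a set \<Rightarrow> 'a set \<Rightarrow> ('a \<Rightarrow> 'a \<Rightarrow> real) \<Rightarrow> real \<Rightarrow> 'a set" where
  "intrinsic_cone G N H d \<alpha> =
    {g \<in> carrier G. d \<one>\<^bsub>G\<^esub> (proj_N G N H g) \<le> \<alpha> * d \<one>\<^bsub>G\<^esub> (proj_H G N H g)}"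

end

theory Submission
  imports Defs
begin

text \<open>For \<open>x\<close> in the graph write \<open>a(x)\<close> and \<open>b(x)\<close> for the distances from \<open>\<one>\<close> of the
  \<open>N\<close>-part and the \<open>H\<close>-part of \<open>p\<^sup>-\<^sup>1 x\<close>. Since translation by \<open>p\<close> is a bijection, the
  cone condition says that \<open>\<alpha> b(x) < a(x)\<close> for every \<open>x \<noteq> p\<close> in the graph, and the Lipschitz
  condition says that \<open>b(x) \<le> L a(x)\<close> for every \<open>x\<close> in the graph.

  The cone condition therefore gives the Lipschitz condition with \<open>L = 1/\<alpha>\<close>; at \<open>x = p\<close>
  the latter reads \<open>0 \<le> 0\<close>. Conversely, the Lipschitz condition gives the cone condition for
  each \<open>\<alpha> > 0\<close> with \<open>\<alpha> L < 1\<close>: if \<open>a(x) \<le> \<alpha> b(x)\<close>, then \<open>a(x) \<le> \<alpha> L a(x)\<close>, which forces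
  \<open>a(x) = 0\<close> and then \<open>b(x) = 0\<close>. As \<open>d\<close> separates points, both parts of \<open>p\<^sup>-\<^sup>1 x\<close> are
  \<open>\<one>\<close>, that is, \<open>x = p\<close>.\<close>

context semidirect_product
begin

lemma proj_factorization:
  assumes "g \<in> carrier G"
  shows "proj_N G N H g \<in> N" "proj_H G N H g \<in> H"
    and "g = proj_N G N H g \<otimes> proj_H G N H g"
proof -
  have "g \<in> N <#> H"
    using assms set_mult_eq by simp
  then obtain n h where "n \<in> N" "h \<in> H" "g = n \<otimes> h"
    by (auto simp: set_mult_def)
  then show "proj_N G N H g \<in> N" "proj_H G N H g \<in> H"
    and "g = proj_N G N H g \<otimes> proj_H G N H g"
    by (simp_all add: proj_eqs)
qed

lemma proj_one: "proj_N G N H \<one> = \<one>" "proj_H G N H \<one> = \<one>"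
  using proj_eqs[OF N.one_closed H.one_closed] by simp_all

lemma intrinsic_graph_subset_carrier:
  assumes "\<phi> \<in> N \<rightarrow> H"
  shows "intrinsic_graph G N \<phi> \<subseteq> carrier G"
  using assms N.subset H.subset by (auto simp: intrinsic_graph_def Pi_iff subset_iff)

end

lemma (in group) mem_l_coset_iff:
  assumes "p \<in> carrier G" "x \<in> carrier G" "C \<subseteq> carrier G"
  shows "x \<in> p <# C \<longleftrightarrow> inv p \<otimes> x \<in> C"
proof
  assume "x \<in> p <# C"
  then show "inv p \<otimes> x \<in> C"
    using assms by (auto simp: l_coset_def m_assoc[symmetric] subset_iff)
next
  assume "inv p \<otimes> x \<in> C"
  moreover have "x = p \<otimes> (inv p \<otimes> x)"
    using assms by (simp add: m_assoc[symmetric])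
  ultimately show "x \<in> p <# C"
    by (auto simp: l_coset_def)
qed

locale metric_semidirect_product = metric_group G T d + semidirect_product G N H
  for G (structure) and T d N H
begin

lemma eq_one_if_proj_dist_zero:
  assumes "g \<in> carrier G" "d \<one> (proj_N G N H g) = 0" "d \<one> (proj_H G N H g) = 0"
  shows "g = \<one>"
proof -
  have "proj_N G N H g \<in> carrier G" "proj_H G N H g \<in> carrier G"
    using proj_factorization[OF assms(1)] N.subset H.subset by auto
  then have "proj_N G N H g = \<one>" "proj_H G N H g = \<one>"
    using assms zero[OF one_closed] by auto
  then show ?thesis
    using proj_factorization(3)[OF assms(1)] by simp
qed

text \<open>The vertex \<open>p\<close> always lies in the translated cone, because both parts of
  \<open>p\<^sup>-\<^sup>1 p = \<one>\<close> are trivial; the content is thus the strict inequality off \<open>p\<close>.\<close>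

lemma cone_meets_only_at_vertex_iff:
  assumes "p \<in> S" "S \<subseteq> carrier G"
  shows "(p <# intrinsic_cone G N H d \<alpha>) \<inter> S = {p} \<longleftrightarrow>
    (\<forall>x\<in>S - {p}. \<alpha> * d \<one> (proj_H G N H (inv p \<otimes> x)) < d \<one> (proj_N G N H (inv p \<otimes> x)))"
proof -
  have mem: "x \<in> p <# intrinsic_cone G N H d \<alpha> \<longleftrightarrow>
      d \<one> (proj_N G N H (inv p \<otimes> x)) \<le> \<alpha> * d \<one> (proj_H G N H (inv p \<otimes> x))"
    if "x \<in> S" for x
  proof -
    have "p \<in> carrier G" "x \<in> carrier G"
      using that assms by auto
    then show ?thesis
      by (subst mem_l_coset_iff) (auto simp: intrinsic_cone_def)
  qed
  have "p \<in> carrier G"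
    using assms by auto
  then have "p \<in> p <# intrinsic_cone G N H d \<alpha>"
    using mem[OF assms(1)] by (simp add: proj_one)
  then have "(p <# intrinsic_cone G N H d \<alpha>) \<inter> S = {p} \<longleftrightarrow>
      (\<forall>x\<in>S - {p}. x \<notin> p <# intrinsic_cone G N H d \<alpha>)"
    using assms(1) by auto
  then show ?thesis
    by (simp add: mem not_le)
qed

lemma Lipschitz_imp_cone_meets_only_at_vertex:
  assumes "p \<in> S" "S \<subseteq> carrier G" and \<alpha>: "0 \<le> \<alpha>" "\<alpha> * L < 1"
    and Lip: "\<forall>x\<in>S. d \<one> (proj_H G N H (inv p \<otimes> x)) \<le> L * d \<one> (proj_N G N H (inv p \<otimes> x))"
  shows "(p <# intrinsic_cone G N H d \<alpha>) \<inter> S = {p}"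
  unfolding cone_meets_only_at_vertex_iff[OF assms(1,2)]
proof (intro ballI, rule ccontr)
  fix x
  define a where "a = d \<one> (proj_N G N H (inv p \<otimes> x))"
  define b where "b = d \<one> (proj_H G N H (inv p \<otimes> x))"
  assume x: "x \<in> S - {p}" and "\<not> \<alpha> * d \<one> (proj_H G N H (inv p \<otimes> x))
      < d \<one> (proj_N G N H (inv p \<otimes> x))"
  then have ab: "a \<le> \<alpha> * b"
    by (simp add: a_def b_def)
  have ba: "b \<le> L * a"
    using Lip x by (simp add: a_def b_def)
  have nonneg: "0 \<le> a" "0 \<le> b"
    by (simp_all add: a_def b_def)
  have "\<alpha> * b \<le> \<alpha> * (L * a)"
    using \<alpha>(1) ba by (rule mult_left_mono[rotated])
  with ab have "(1 - \<alpha> * L) * a \<le> 0"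
    by (simp add: algebra_simps)
  with \<alpha>(2) nonneg(1) have "a = 0"
    by (simp add: mult_le_0_iff)
  with ba nonneg(2) have "b = 0"
    by simp
  have px: "p \<in> carrier G" "x \<in> carrier G"
    using assms(1,2) x by auto
  have "inv p \<otimes> x = \<one>"
    using eq_one_if_proj_dist_zero[of "inv p \<otimes> x"] px \<open>a = 0\<close> \<open>b = 0\<close>
    by (simp add: a_def b_def)
  then have "x = p"
    using px by (simp add: inv_solve_left')
  with x show False
    by simp
qed

lemma cone_meets_only_at_vertex_imp_Lipschitz:
  assumes "p \<in> S" "S \<subseteq> carrier G" "0 < \<alpha>"
    and cone: "(p <# intrinsic_cone G N H d \<alpha>) \<inter> S = {p}"
  shows "\<forall>x\<in>S. d \<one> (proj_H G N H (inv p \<otimes> x)) \<le> 1 / \<alpha> * d \<one> (proj_N G N H (inv p \<otimes> x))"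
proof
  fix x assume "x \<in> S"
  show "d \<one> (proj_H G N H (inv p \<otimes> x)) \<le> 1 / \<alpha> * d \<one> (proj_N G N H (inv p \<otimes> x))"
  proof (cases "x = p")
    case True
    have "p \<in> carrier G"
      using assms(1,2) by auto
    with True show ?thesis
      by (simp add: proj_one)
  next
    case False
    with \<open>x \<in> S\<close> cone
    have "\<alpha> * d \<one> (proj_H G N H (inv p \<otimes> x)) < d \<one> (proj_N G N H (inv p \<otimes> x))"
      by (simp add: cone_meets_only_at_vertex_iff[OF assms(1,2)])
    with \<open>0 < \<alpha>\<close> show ?thesis
      by (simp add: field_simps)
  qed
qed

end

theorem proposition3p8:
  fixes G :: "('a, 'b) monoid_scheme" and T :: "'a topology" and d :: "'a \<Rightarrow> 'a \<Rightarrow> real"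
    and N H :: "'a set" and \<phi> :: "'a \<Rightarrow> 'a" and m p :: 'a
  assumes "metric_group G T d"
    and "semidirect_product G N H"
    and "Lipschitz_continuous_map
           (metric (carrier G, d)) (submetric (metric (carrier G, d)) H) (proj_H G N H)"
    and "\<phi> \<in> N \<rightarrow> H"
    and "m \<in> N"
    and "p = m \<otimes>\<^bsub>G\<^esub> \<phi> m"
  shows "(\<exists>L>0. intrinsically_Lipschitz_at G N H d L \<phi> m) \<longleftrightarrow>
    (\<exists>\<alpha>\<in>{0<..<1}. (p <#\<^bsub>G\<^esub> intrinsic_cone G N H d \<alpha>) \<inter> intrinsic_graph G N \<phi> = {p})"
proof -
  interpret metric_semidirect_product G T d N H
    using assms(1,2) by (rule metric_semidirect_product.intro)
  have p: "p \<in> intrinsic_graph G N \<phi>"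
    using assms(5,6) by (auto simp: intrinsic_graph_def)
  note graph = intrinsic_graph_subset_carrier[OF assms(4)]
  have Lip_iff: "intrinsically_Lipschitz_at G N H d L \<phi> m \<longleftrightarrow>
      (\<forall>x\<in>intrinsic_graph G N \<phi>. d \<one>\<^bsub>G\<^esub> (proj_H G N H (inv\<^bsub>G\<^esub> p \<otimes>\<^bsub>G\<^esub> x))
        \<le> L * d \<one>\<^bsub>G\<^esub> (proj_N G N H (inv\<^bsub>G\<^esub> p \<otimes>\<^bsub>G\<^esub> x)))" for L
    by (simp add: intrinsically_Lipschitz_at_def Let_def assms(6))
  show ?thesis
  proof
    assume "\<exists>L>0. intrinsically_Lipschitz_at G N H d L \<phi> m"
    then obtain L where L: "0 < L" "intrinsically_Lipschitz_at G N H d L \<phi> m"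
      by blast
    \<comment> \<open>This choice makes both \<open>\<alpha> < 1\<close> and \<open>\<alpha> * L < 1\<close>.\<close>
    define \<alpha> where "\<alpha> = 1 / (L + 1)"
    have "0 < \<alpha>" "\<alpha> < 1" "\<alpha> * L < 1"
      using L(1) by (simp_all add: \<alpha>_def)
    then show "\<exists>\<alpha>\<in>{0<..<1}. (p <#\<^bsub>G\<^esub> intrinsic_cone G N H d \<alpha>) \<inter> intrinsic_graph G N \<phi> = {p}"
      using Lipschitz_imp_cone_meets_only_at_vertex[OF p graph, of \<alpha> L] L(2)
      by (intro bexI[of _ \<alpha>]) (auto simp: Lip_iff)
  next
    assume "\<exists>\<alpha>\<in>{0<..<1}. (p <#\<^bsub>G\<^esub> intrinsic_cone G N H d \<alpha>) \<inter> intrinsic_graph G N \<phi> = {p}"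
    then obtain \<alpha> where "0 < \<alpha>"
      and "(p <#\<^bsub>G\<^esub> intrinsic_cone G N H d \<alpha>) \<inter> intrinsic_graph G N \<phi> = {p}"
      by auto
    then have "intrinsically_Lipschitz_at G N H d (1 / \<alpha>) \<phi> m"
      unfolding Lip_iff by (rule cone_meets_only_at_vertex_imp_Lipschitz[OF p graph])
    with \<open>0 < \<alpha>\<close> show "\<exists>L>0. intrinsically_Lipschitz_at G N H d L \<phi> m"
      by (intro exI[of _ "1 / \<alpha>"]) simp
  qed
qed

end
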